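(* Let $M$ be a connected orientable $2$-manifold with a globally defined null coordinate system $(u,v)$. Let $q$ and $r$ be, respectively, a Lorentz holomorphic and a Lorentz antiholomorphic map on $M$. Then $$\begin{aligned}\varphi_u&=\left(\tfrac12(1+q^2),\,-\tfrac12(1-q^2),\,-q\right)f(u),\\ \varphi_v&=\left(-\tfrac12(1+r^2),\,-\tfrac12(1-r^2),\,-r\right)g(v)\end{aligned}$$ define a timelike minimal surface $\varphi:M\to\mathbb{E}^3_1$. Here $f(u)$ and $g(v)$ are Lorentz holomorphic and Lorentz antiholomorphic maps, respectively. The metric of $\varphi$ is given by $ds_\varphi^2=(1+qr)^2f(u)g(v)\,du\,dv$. Conversely, any timelike minimal surface in $\mathbb{E}^3_1$ can be represented by these formulas up to translations.
   Context: $\mathbb{E}^3_1$ is Minkowski $3$-space: $\mathbb{R}^3$ with coordinates $(x_1,x_2,x_3)$ and metric $\langle\ ,\ \rangle=-dx_1^2+dx_2^2+dx_3^2$. The maps $q,r,f,g$ are real-valued functions. A function $h$ is Lorentz holomorphic if $h_v=0$, i.e. $h=h(u)$, and Lorentz antiholomorphic if $h_u=0$, i.e. $h=h(v)$. A timelike surface is an immersion $\varphi$ whose induced metric is Lorentzian. It is parametrized by null coordinates $(u,v)$, meaning $\langle\varphi_u,\varphi_u\rangle=\langle\varphi_v,\varphi_v\rangle=0$ and $\langle\varphi_u,\varphi_v\rangle=\frac12e^\omega$ for a function $\omega$, so the metric is $ds^2_\varphi=e^\omega\,du\,dv$. With $N$ a unit normal field, $\langle N,N\rangle=1$, the mean curvature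 is $H=2e^{-\omega}\langle\varphi_{uv},N\rangle$; the surface is minimal if $H=0$.
   Formalization: "Define a timelike minimal surface" is proved where (1+qr)²fg>0 (else no immersion, or replace u by −u); the converse is global if φ_u is never parallel to (1,1,0) nor φ_v to (1,−1,0) (there q or r would be infinite), and otherwise local, after possibly exchanging u and v. *)

theory Defs
  imports "HOL-Analysis.Analysis"
begin

text \<open>A connected surface with a globally defined null coordinate system \<open>(u,v)\<close> is identified
  with its image under these coordinates, a connected open set of pairs of real numbers.\<close>

primrec differentiable_of_order :: "nat \<Rightarrow> 'a::real_normed_vector set \<Rightarrow> ('a \<Rightarrow> 'b::real_normed_vector) \<Rightarrow> bool" where
  "differentiable_of_order 0 S F \<longleftrightarrow> continuous_on S F"
| "differentiable_of_order (Suc n) S F \<longleftrightarrow>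
     (\<forall>p\<in>S. F differentiable (at p)) \<and>
     (\<forall>h. differentiable_of_order n S (\<lambda>p. frechet_derivative F (at p) h))"

definition smooth_on :: "'a::real_normed_vector set \<Rightarrow> ('a \<Rightarrow> 'b::real_normed_vector) \<Rightarrow> bool" where
  "smooth_on S F \<longleftrightarrow> (\<forall>n. differentiable_of_order n S F)"

definition partial_u :: "(real \<times> real \<Rightarrow> 'b::real_normed_vector) \<Rightarrow> real \<times> real \<Rightarrow> 'b" where
  "partial_u F p = frechet_derivative F (at p) (1, 0)"

definition partial_v :: "(real \<times> real \<Rightarrow> 'b::real_normed_vector) \<Rightarrow> real \<times> real \<Rightarrow> 'b" where
  "partial_v F p = frechet_derivative F (at p) (0, 1)"

definition lorentz_holomorphic :: "(real \<times> real) set \<Rightarrow> (real \<times> real \<Rightarrow> real) \<Rightarrow> bool" where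
  "lorentz_holomorphic M h \<longleftrightarrow> smooth_on M h \<and> (\<forall>p\<in>M. partial_v h p = 0)"

definition lorentz_antiholomorphic :: "(real \<times> real) set \<Rightarrow> (real \<times> real \<Rightarrow> real) \<Rightarrow> bool" where
  "lorentz_antiholomorphic M h \<longleftrightarrow> smooth_on M h \<and> (\<forall>p\<in>M. partial_u h p = 0)"

text \<open>If some line \<open>u = const\<close> meets \<open>M\<close> in a disconnected set, \<open>partial_v h = 0\<close> on \<open>M\<close> is
  weaker than \<open>h = h(u)\<close> on all of \<open>M\<close>. The following two predicates express the global property.\<close>

definition function_of_u :: "(real \<times> real) set \<Rightarrow> (real \<times> real \<Rightarrow> real) \<Rightarrow> bool" where
  "function_of_u M h \<longleftrightarrow> (\<exists>k. \<forall>(u, v)\<in>M. h (u, v) = k u)"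

definition function_of_v :: "(real \<times> real) set \<Rightarrow> (real \<times> real \<Rightarrow> real) \<Rightarrow> bool" where
  "function_of_v M h \<longleftrightarrow> (\<exists>k. \<forall>(u, v)\<in>M. h (u, v) = k v)"

definition minkowski :: "real^3 \<Rightarrow> real^3 \<Rightarrow> real" where
  "minkowski x y = - (x $ 1 * y $ 1) + x $ 2 * y $ 2 + x $ 3 * y $ 3"

definition induced_metric ::
  "(real \<times> real \<Rightarrow> real^3) \<Rightarrow> real \<times> real \<Rightarrow> real \<times> real \<Rightarrow> real \<times> real \<Rightarrow> real" where
  "induced_metric \<phi> p X Y =
     minkowski (frechet_derivative \<phi> (at p) X) (frechet_derivative \<phi> (at p) Y)"

definition lorentzian_form :: "(real \<times> real \<Rightarrow> real \<times> real \<Rightarrow> real) \<Rightarrow> bool" where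
  "lorentzian_form B \<longleftrightarrow> (\<exists>X Y. B X X = -1 \<and> B Y Y = 1 \<and> B X Y = 0)"

definition timelike_surface :: "(real \<times> real) set \<Rightarrow> (real \<times> real \<Rightarrow> real^3) \<Rightarrow> bool" where
  "timelike_surface M \<phi> \<longleftrightarrow> smooth_on M \<phi> \<and>
     (\<forall>p\<in>M. inj (frechet_derivative \<phi> (at p)) \<and> lorentzian_form (induced_metric \<phi> p))"

definition null_coordinates ::
  "(real \<times> real) set \<Rightarrow> (real \<times> real \<Rightarrow> real^3) \<Rightarrow> (real \<times> real \<Rightarrow> real) \<Rightarrow> bool" where
  "null_coordinates M \<phi> \<omega> \<longleftrightarrow> (\<forall>p\<in>M.
     minkowski (partial_u \<phi> p) (partial_u \<phi> p) = 0 \<and>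
     minkowski (partial_v \<phi> p) (partial_v \<phi> p) = 0 \<and>
     minkowski (partial_u \<phi> p) (partial_v \<phi> p) = exp (\<omega> p) / 2)"

definition unit_normal_field ::
  "(real \<times> real) set \<Rightarrow> (real \<times> real \<Rightarrow> real^3) \<Rightarrow> (real \<times> real \<Rightarrow> real^3) \<Rightarrow> bool" where
  "unit_normal_field M \<phi> N \<longleftrightarrow> smooth_on M N \<and> (\<forall>p\<in>M.
     minkowski (N p) (N p) = 1 \<and>
     (\<forall>X. minkowski (frechet_derivative \<phi> (at p) X) (N p) = 0))"

definition mean_curvature ::
  "(real \<times> real \<Rightarrow> real^3) \<Rightarrow> (real \<times> real \<Rightarrow> real) \<Rightarrow> (real \<times> real \<Rightarrow> real^3) \<Rightarrow> real \<times> real \<Rightarrow> real" where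
  "mean_curvature \<phi> \<omega> N p = 2 * exp (- \<omega> p) * minkowski (partial_v (partial_u \<phi>) p) (N p)"

text \<open>The choice of unit normal is immaterial: the other one only changes the sign of the mean
  curvature.\<close>

definition timelike_minimal_surface ::
  "(real \<times> real) set \<Rightarrow> (real \<times> real \<Rightarrow> real^3) \<Rightarrow> (real \<times> real \<Rightarrow> real) \<Rightarrow> bool" where
  "timelike_minimal_surface M \<phi> \<omega> \<longleftrightarrow>
     timelike_surface M \<phi> \<and> null_coordinates M \<phi> \<omega> \<and>
     (\<exists>N. unit_normal_field M \<phi> N \<and> (\<forall>p\<in>M. mean_curvature \<phi> \<omega> N p = 0))"

definition weierstrass_formulas ::
  "(real \<times> real) set \<Rightarrow> (real \<times> real \<Rightarrow> real) \<Rightarrow> (real \<times> real \<Rightarrow> real) \<Rightarrow>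
   (real \<times> real \<Rightarrow> real) \<Rightarrow> (real \<times> real \<Rightarrow> real) \<Rightarrow> (real \<times> real \<Rightarrow> real^3) \<Rightarrow> bool" where
  "weierstrass_formulas M q r f g \<phi> \<longleftrightarrow> (\<forall>p\<in>M. \<phi> differentiable (at p) \<and>
     partial_u \<phi> p = f p *\<^sub>R vector [(1 + (q p)\<^sup>2) / 2, - ((1 - (q p)\<^sup>2) / 2), - q p] \<and>
     partial_v \<phi> p = g p *\<^sub>R vector [- ((1 + (r p)\<^sup>2) / 2), - ((1 - (r p)\<^sup>2) / 2), - r p])"

text \<open>Representability up to translations: the data define a surface, and \<open>\<phi>\<close> is a translate of
  every surface they define.\<close>

definition weierstrass_representable :: "(real \<times> real) set \<Rightarrow> (real \<times> real \<Rightarrow> real^3) \<Rightarrow> bool" where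
  "weierstrass_representable M \<phi> \<longleftrightarrow> (\<exists>q r f g.
     lorentz_holomorphic M q \<and> lorentz_antiholomorphic M r \<and>
     lorentz_holomorphic M f \<and> lorentz_antiholomorphic M g \<and>
     (\<exists>\<psi>. weierstrass_formulas M q r f g \<psi>) \<and>
     (\<forall>\<psi>. weierstrass_formulas M q r f g \<psi> \<longrightarrow> (\<exists>c. \<forall>p\<in>M. \<phi> p = \<psi> p + c)))"

end

theory Submission
  imports Defs
begin

text \<open>The two vectors of the formulas are null by an algebraic identity, and their product
  \<open>(1 + qr)\<^sup>2 f g / 2\<close> is the metric; as \<open>\<phi>\<^sub>u\<close> depends only on \<open>u\<close>, \<open>\<phi>\<^sub>u\<^sub>v = 0\<close> and the mean
  curvature vanishes. A primitive in \<open>u\<close> plus a primitive in \<open>v\<close> integrates the formulas.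

  Conversely, differentiating the null conditions shows that \<open>\<phi>\<^sub>u\<^sub>v\<close> is orthogonal to \<open>\<phi>\<^sub>u\<close> and
  \<open>\<phi>\<^sub>v\<close>, and \<open>H = 0\<close> that it is orthogonal to the normal, so \<open>\<phi>\<^sub>u\<^sub>v = 0\<close>. For \<open>x = \<phi>\<^sub>u\<close> and
  \<open>y = \<phi>\<^sub>v\<close> the data are then \<open>f = x\<^sub>1 - x\<^sub>2\<close>, \<open>q = - x\<^sub>3 / f\<close>, \<open>g = - (y\<^sub>1 + y\<^sub>2)\<close>, \<open>r = - y\<^sub>3 / g\<close>. If
  \<open>f\<close> or \<open>g\<close> vanishes at a point, then, the null vectors \<open>x\<close> and \<open>y\<close> not being orthogonal, the
  denominators obtained after exchanging \<open>u\<close> and \<open>v\<close> do not.\<close>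

section \<open>Calculus of smooth functions\<close>

lemma frechet_derivative_eqI:
  assumes "(F has_derivative D) (at p)"
  shows "frechet_derivative F (at p) = D"
  using frechet_derivative_at[OF assms] by simp

lemma frechet_derivative_cong_open:
  assumes "open S" "p \<in> S" "\<And>x. x \<in> S \<Longrightarrow> F x = G x" "F differentiable (at p)"
  shows "frechet_derivative F (at p) = frechet_derivative G (at p)"
  using frechet_derivative_transform_within_open[OF assms(4,1,2)] assms(3) by blast

lemma differentiable_cong_open:
  assumes "open S" "p \<in> S" "\<And>x. x \<in> S \<Longrightarrow> F x = G x" "F differentiable (at p)"
  shows "G differentiable (at p)"
  using assms has_derivative_transform_within_open unfolding differentiable_def by blast

lemma differentiable_of_order_imp_differentiable:
  "differentiable_of_order (Suc n) S F \<Longrightarrow> p \<in> S \<Longrightarrow> F differentiable (at p)"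
  by simp

text \<open>An open \<open>S\<close> contains a neighbourhood of each of its points, so functions
  that agree on \<open>S\<close> share their derivatives there. The closure lemmas below use this to
  replace a derivative by a formula known only on \<open>S\<close>.\<close>

lemma differentiable_of_order_cong:
  assumes "open S" "\<And>x. x \<in> S \<Longrightarrow> F x = G x" "differentiable_of_order n S F"
  shows "differentiable_of_order n S G"
  using assms(2,3)
proof (induction n arbitrary: F G)
  case 0
  then show ?case by (metis continuous_on_cong differentiable_of_order.simps(1))
next
  case (Suc n)
  have "G differentiable (at p)" if "p \<in> S" for p
    using differentiable_cong_open[OF assms(1) that, of F G] Suc.prems that by auto
  moreover have "differentiable_of_order n S (\<lambda>p. frechet_derivative G (at p) h)" for h
  proof (rule Suc.IH[of "\<lambda>p. frechet_derivative F (at p) h"])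
    show "frechet_derivative F (at x) h = frechet_derivative G (at x) h" if "x \<in> S" for x
      using frechet_derivative_cong_open[OF assms(1) that, of F G] Suc.prems that by auto
    show "differentiable_of_order n S (\<lambda>p. frechet_derivative F (at p) h)"
      using Suc.prems by simp
  qed
  ultimately show ?case by simp
qed

lemma differentiable_of_order_SucD:
  assumes "differentiable_of_order (Suc n) S F"
  shows "differentiable_of_order n S F"
  using assms
proof (induction n arbitrary: F)
  case 0
  then show ?case
    by (auto intro!: continuous_at_imp_continuous_on differentiable_imp_continuous_within)
next
  case (Suc n)
  then show ?case
    by (metis differentiable_of_order.simps(2))
qed

lemma differentiable_of_order_subset:
  "differentiable_of_order n S F \<Longrightarrow> T \<subseteq> S \<Longrightarrow> differentiable_of_order n T F"
  by (induction n arbitrary: F) (auto intro: continuous_on_subset)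

lemma differentiable_of_order_const: "differentiable_of_order n S (\<lambda>p. c)"
  by (induction n arbitrary: c) auto

lemma differentiable_of_order_add:
  assumes "open S" "differentiable_of_order n S F" "differentiable_of_order n S G"
  shows "differentiable_of_order n S (\<lambda>p. F p + G p)"
  using assms(2,3)
proof (induction n arbitrary: F G)
  case 0
  then show ?case by (auto intro: continuous_on_add)
next
  case (Suc n)
  have "frechet_derivative (\<lambda>p. F p + G p) (at p)
      = (\<lambda>h. frechet_derivative F (at p) h + frechet_derivative G (at p) h)" if "p \<in> S" for p
    using Suc.prems that
    by (intro frechet_derivative_eqI has_derivative_add) (auto simp: frechet_derivative_works)
  with Suc show ?case
    by (auto intro!: differentiable_add
        intro: differentiable_of_order_cong[OF assms(1), where F = "\<lambda>p. frechet_derivative F (at p) h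
          + frechet_derivative G (at p) h" for h])
qed

text \<open>By the product rule a derivative is a sum of two terms of the same bilinear shape, so
  the induction closes with both factors arbitrary. The instances used are multiplication and
  scaling.\<close>

lemma differentiable_of_order_bilinear:
  assumes "open S" "bounded_bilinear B"
    and "differentiable_of_order n S F" "differentiable_of_order n S G"
  shows "differentiable_of_order n S (\<lambda>p. B (F p) (G p))"
  using assms(3,4)
proof (induction n arbitrary: F G)
  case 0
  then show ?case by (auto intro: bounded_bilinear.continuous_on[OF assms(2)])
next
  case (Suc n)
  have D: "((\<lambda>p. B (F p) (G p)) has_derivative
      (\<lambda>h. B (F p) (frechet_derivative G (at p) h) + B (frechet_derivative F (at p) h) (G p))) (at p)"
    if "p \<in> S" for p
    using Suc.prems that
    by (intro bounded_bilinear.FDERIV[OF assms(2)]) (auto simp: frechet_derivative_works)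
  have "differentiable_of_order n S (\<lambda>p. frechet_derivative (\<lambda>p. B (F p) (G p)) (at p) h)" for h
  proof (rule differentiable_of_order_cong[OF assms(1)])
    show "differentiable_of_order n S
      (\<lambda>p. B (F p) (frechet_derivative G (at p) h) + B (frechet_derivative F (at p) h) (G p))"
      using Suc.prems
      by (intro differentiable_of_order_add[OF assms(1)] Suc.IH)
        (auto intro: differentiable_of_order_SucD)
  qed (simp add: frechet_derivative_eqI[OF D])
  with D show ?case by (auto simp: differentiable_def)
qed

lemma differentiable_of_order_linear:
  assumes "open S" "bounded_linear L" "differentiable_of_order n S F"
  shows "differentiable_of_order n S (\<lambda>p. L (F p))"
  using assms(3)
proof (induction n arbitrary: F)
  case 0
  then show ?case by (auto intro: bounded_linear.continuous_on[OF assms(2)])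
next
  case (Suc n)
  have D: "((\<lambda>p. L (F p)) has_derivative (\<lambda>h. L (frechet_derivative F (at p) h))) (at p)"
    if "p \<in> S" for p
    using Suc.prems that
    by (intro bounded_linear.has_derivative[OF assms(2)]) (auto simp: frechet_derivative_works)
  have "differentiable_of_order n S (\<lambda>p. frechet_derivative (\<lambda>p. L (F p)) (at p) h)" for h
    by (rule differentiable_of_order_cong[OF assms(1) _ Suc.IH])
      (use Suc.prems in \<open>auto simp: frechet_derivative_eqI[OF D]\<close>)
  with D show ?case by (auto simp: differentiable_def)
qed

text \<open>The derivative of the reciprocal contains the reciprocal itself only undifferentiated,
  so order \<open>n\<close> of \<open>inverse (F p)\<close> is enough for order
  \<open>Suc n\<close>.\<close>

lemma differentiable_of_order_inverse:
  fixes F :: "'a::real_normed_vector \<Rightarrow> real"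
  assumes "open S" "\<And>p. p \<in> S \<Longrightarrow> F p \<noteq> 0" "differentiable_of_order n S F"
  shows "differentiable_of_order n S (\<lambda>p. inverse (F p))"
  using assms(3)
proof (induction n)
  case 0
  then show ?case using assms(2) by (auto intro: continuous_on_inverse)
next
  case (Suc n)
  have D: "((\<lambda>p. inverse (F p)) has_derivative
      (\<lambda>h. - (inverse (F p) * frechet_derivative F (at p) h * inverse (F p)))) (at p)"
    if "p \<in> S" for p
    using Suc.prems that assms(2)
    by (intro Deriv.has_derivative_inverse) (auto simp: frechet_derivative_works)
  have "differentiable_of_order n S (\<lambda>p. frechet_derivative (\<lambda>p. inverse (F p)) (at p) h)" for h
  proof (rule differentiable_of_order_cong[OF assms(1)])
    show "differentiable_of_order n S
      (\<lambda>p. - (inverse (F p) * frechet_derivative F (at p) h * inverse (F p)))"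
      using Suc.prems
      by (intro differentiable_of_order_linear[OF assms(1) bounded_linear_minus[OF bounded_linear_ident]]
          differentiable_of_order_bilinear[OF assms(1) bounded_bilinear_mult] Suc.IH)
        (auto intro: differentiable_of_order_SucD)
  qed (simp add: frechet_derivative_eqI[OF D])
  with D show ?case by (auto simp: differentiable_def)
qed

text \<open>A linear inner map is its own derivative at every point: the composite differentiated in
  direction \<open>h\<close> is \<open>F\<close> differentiated in the fixed direction
  \<open>L h\<close>, again composed with \<open>L\<close>. The lemma serves the exchange of the two
  coordinates.\<close>

lemma differentiable_of_order_compose_linear:
  assumes "open S" "open T" "bounded_linear L" "L ` T \<subseteq> S" "differentiable_of_order n S F"
  shows "differentiable_of_order n T (\<lambda>p. F (L p))"
  using assms(5)
proof (induction n arbitrary: F)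
  case 0
  have "continuous_on T L"
    by (intro linear_continuous_on assms)
  with 0 assms(4) show ?case
    by (auto intro: continuous_on_compose2)
next
  case (Suc n)
  have D: "((\<lambda>p. F (L p)) has_derivative (\<lambda>h. frechet_derivative F (at (L p)) (L h))) (at p)"
    if "p \<in> T" for p
    using Suc.prems that assms(4) 
    by (intro has_derivative_compose[OF bounded_linear_imp_has_derivative[OF assms(3)]])
      (auto simp: frechet_derivative_works)
  have "differentiable_of_order n T (\<lambda>p. frechet_derivative (\<lambda>p. F (L p)) (at p) h)" for h
    by (rule differentiable_of_order_cong[OF assms(2) _ Suc.IH])
      (use Suc.prems in \<open>auto simp: frechet_derivative_eqI[OF D]\<close>)
  with D show ?case by (auto simp: differentiable_def)
qed

section \<open>Closure properties of smooth functions\<close>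

lemma smooth_on_differentiable: "smooth_on S F \<Longrightarrow> p \<in> S \<Longrightarrow> F differentiable (at p)"
  unfolding smooth_on_def using differentiable_of_order_imp_differentiable by blast

lemma smooth_on_frechet_derivative:
  "smooth_on S F \<Longrightarrow> smooth_on S (\<lambda>p. frechet_derivative F (at p) h)"
  unfolding smooth_on_def using differentiable_of_order.simps(2) by blast

lemma smooth_onI_frechet:
  assumes "\<And>p. p \<in> S \<Longrightarrow> F differentiable (at p)"
    and "\<And>h. smooth_on S (\<lambda>p. frechet_derivative F (at p) h)"
  shows "smooth_on S F"
proof -
  have "differentiable_of_order (Suc n) S F" for n
    using assms unfolding smooth_on_def by simp
  then show ?thesis
    unfolding smooth_on_def using differentiable_of_order_SucD by blast
qed

lemma smooth_on_continuous: "smooth_on S F \<Longrightarrow> continuous_on S F"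
  unfolding smooth_on_def using differentiable_of_order.simps(1) by blast

lemma smooth_on_cong:
  "open S \<Longrightarrow> smooth_on S F \<Longrightarrow> (\<And>x. x \<in> S \<Longrightarrow> F x = G x) \<Longrightarrow> smooth_on S G"
  unfolding smooth_on_def using differentiable_of_order_cong by blast

lemma smooth_on_subset: "smooth_on S F \<Longrightarrow> T \<subseteq> S \<Longrightarrow> smooth_on T F"
  unfolding smooth_on_def using differentiable_of_order_subset by blast

lemma smooth_on_const: "smooth_on S (\<lambda>p. c)"
  unfolding smooth_on_def using differentiable_of_order_const by blast

lemma smooth_on_add:
  "open S \<Longrightarrow> smooth_on S F \<Longrightarrow> smooth_on S G \<Longrightarrow> smooth_on S (\<lambda>p. F p + G p)"
  unfolding smooth_on_def using differentiable_of_order_add by blast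

lemma smooth_on_bilinear:
  "open S \<Longrightarrow> bounded_bilinear B \<Longrightarrow> smooth_on S F \<Longrightarrow> smooth_on S G \<Longrightarrow>
   smooth_on S (\<lambda>p. B (F p) (G p))"
  unfolding smooth_on_def using differentiable_of_order_bilinear by blast

lemmas smooth_on_mult = smooth_on_bilinear[OF _ bounded_bilinear_mult]
lemmas smooth_on_scaleR = smooth_on_bilinear[OF _ bounded_bilinear_scaleR]

lemma smooth_on_linear:
  "open S \<Longrightarrow> bounded_linear L \<Longrightarrow> smooth_on S F \<Longrightarrow> smooth_on S (\<lambda>p. L (F p))"
  unfolding smooth_on_def using differentiable_of_order_linear by blast

lemmas smooth_on_minus = smooth_on_linear[OF _ bounded_linear_minus[OF bounded_linear_ident]]
lemmas smooth_on_vec_nth = smooth_on_linear[OF _ bounded_linear_vec_nth]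

lemma smooth_on_diff:
  "open S \<Longrightarrow> smooth_on S F \<Longrightarrow> smooth_on S G \<Longrightarrow> smooth_on S (\<lambda>p. F p - G p)"
  using smooth_on_add[of S F "\<lambda>p. - G p"] smooth_on_minus[of S G] by simp

lemma smooth_on_divide:
  fixes F G :: "'a::real_normed_vector \<Rightarrow> real"
  assumes "open S" "smooth_on S F" "smooth_on S G" "\<And>p. p \<in> S \<Longrightarrow> G p \<noteq> 0"
  shows "smooth_on S (\<lambda>p. F p / G p)"
proof -
  have "smooth_on S (\<lambda>p. inverse (G p))"
    using assms differentiable_of_order_inverse unfolding smooth_on_def by blast
  from smooth_on_mult[OF assms(1,2) this] show ?thesis
    by (simp add: divide_inverse)
qed

lemma smooth_on_power2:
  fixes F :: "'a::real_normed_vector \<Rightarrow> real"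
  shows "open S \<Longrightarrow> smooth_on S F \<Longrightarrow> smooth_on S (\<lambda>p. (F p)\<^sup>2)"
  unfolding power2_eq_square by (rule smooth_on_mult)

lemma smooth_on_vector_3:
  assumes "open S" "smooth_on S a" "smooth_on S b" "smooth_on S c"
  shows "smooth_on S (\<lambda>p. vector [a p, b p, c p] :: real^3)"
proof -
  \<comment> \<open>Along the axes the vector becomes a sum of scaled constants, to which the
    closure rules apply.\<close>
  have "smooth_on S (\<lambda>p. a p *\<^sub>R axis 1 1 + b p *\<^sub>R axis 2 1 + c p *\<^sub>R axis 3 1 :: real^3)"
    by (intro smooth_on_add smooth_on_scaleR smooth_on_const assms)
  then show ?thesis
    by (rule smooth_on_cong[OF assms(1)]) (simp add: vec_eq_iff forall_3 axis_def)
qed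

lemma smooth_on_compose_linear:
  "open S \<Longrightarrow> open T \<Longrightarrow> bounded_linear L \<Longrightarrow> L ` T \<subseteq> S \<Longrightarrow> smooth_on S F \<Longrightarrow>
   smooth_on T (\<lambda>p. F (L p))"
  unfolding smooth_on_def using differentiable_of_order_compose_linear by blast

lemmas smooth_on_intros = smooth_on_const smooth_on_add smooth_on_diff smooth_on_minus smooth_on_mult
  smooth_on_scaleR smooth_on_power2 smooth_on_divide smooth_on_vec_nth smooth_on_vector_3

section \<open>Partial derivatives\<close>

lemma smooth_on_partial_u: "smooth_on S F \<Longrightarrow> smooth_on S (partial_u F)"
  and smooth_on_partial_v: "smooth_on S F \<Longrightarrow> smooth_on S (partial_v F)"
  using smooth_on_frechet_derivative[of S F "(1, 0)"] smooth_on_frechet_derivative[of S F "(0, 1)"]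
  unfolding partial_u_def[abs_def] partial_v_def[abs_def] by auto

lemma frechet_derivative_partials:
  assumes "F differentiable (at p)"
  shows "frechet_derivative F (at p) (a, b) = a *\<^sub>R partial_u F p + b *\<^sub>R partial_v F p"
proof -
  interpret linear "frechet_derivative F (at p)"
    by (rule linear_frechet_derivative[OF assms])
  have "(a, b) = a *\<^sub>R (1, 0) + b *\<^sub>R (0, 1)" by simp
  then show ?thesis unfolding partial_u_def partial_v_def by (metis add scale)
qed

lemma has_derivative_partials:
  assumes "F differentiable (at p)"
  shows "(F has_derivative (\<lambda>h. fst h *\<^sub>R partial_u F p + snd h *\<^sub>R partial_v F p)) (at p)"
proof -
  have "frechet_derivative F (at p) = (\<lambda>h. fst h *\<^sub>R partial_u F p + snd h *\<^sub>R partial_v F p)"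
    using frechet_derivative_partials[OF assms] by auto
  then show ?thesis using assms by (simp add: frechet_derivative_works)
qed

lemma partial_eqI:
  assumes "(F has_derivative D) (at p)"
  shows partial_u_eqI: "partial_u F p = D (1, 0)" and partial_v_eqI: "partial_v F p = D (0, 1)"
  using frechet_derivative_eqI[OF assms] by (auto simp: partial_u_def partial_v_def)

lemma partial_cong:
  assumes "open S" "p \<in> S" "F differentiable (at p)" "\<And>x. x \<in> S \<Longrightarrow> F x = G x"
  shows partial_u_cong: "partial_u F p = partial_u G p"
    and partial_v_cong: "partial_v F p = partial_v G p"
  using frechet_derivative_cong_open[OF assms(1,2,4,3)] by (auto simp: partial_u_def partial_v_def)

lemma bounded_linear_swap: "bounded_linear (prod.swap :: real \<times> real \<Rightarrow> real \<times> real)"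
proof -
  have "bounded_linear (\<lambda>p::real \<times> real. (snd p, fst p))"
    by (intro bounded_linear_Pair bounded_linear_fst bounded_linear_snd)
  then show ?thesis by (simp add: prod.swap_def[abs_def])
qed

lemma partial_swap:
  assumes "F differentiable (at (prod.swap p))"
  shows partial_u_swap: "partial_u (\<lambda>x. F (prod.swap x)) p = partial_v F (prod.swap p)"
    and partial_v_swap: "partial_v (\<lambda>x. F (prod.swap x)) p = partial_u F (prod.swap p)"
    and differentiable_swap: "(\<lambda>x. F (prod.swap x)) differentiable (at p)"
proof -
  have D: "((\<lambda>x. F (prod.swap x)) has_derivative
      (\<lambda>h. frechet_derivative F (at (prod.swap p)) (prod.swap h))) (at p)"
    by (rule has_derivative_compose[OF bounded_linear_imp_has_derivative[OF bounded_linear_swap]])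
      (use assms in \<open>simp add: frechet_derivative_works\<close>)
  show "partial_u (\<lambda>x. F (prod.swap x)) p = partial_v F (prod.swap p)"
    and "partial_v (\<lambda>x. F (prod.swap x)) p = partial_u F (prod.swap p)"
    using partial_eqI[OF D] by (auto simp: partial_u_def partial_v_def)
  show "(\<lambda>x. F (prod.swap x)) differentiable (at p)"
    using D by (auto simp: differentiable_def)
qed

section \<open>Symmetry of the mixed partial derivatives\<close>

lemma has_field_derivative_partial_u:
  fixes F :: "real \<times> real \<Rightarrow> real"
  assumes "F differentiable (at (x, y))"
  shows "((\<lambda>t. F (t, y)) has_field_derivative partial_u F (x, y)) (at x)"
proof -
  have "((\<lambda>t. F (t, y)) has_derivative
      (\<lambda>h. fst (h, 0::real) *\<^sub>R partial_u F (x, y) + snd (h, 0::real) *\<^sub>R partial_v F (x, y))) (at x)"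
    by (rule has_derivative_compose[where f = "\<lambda>t. (t, y)", OF _ has_derivative_partials[OF assms]])
      (auto intro!: derivative_eq_intros)
  then show ?thesis by (simp add: has_field_derivative_def mult.commute[of _ "partial_u F (x, y)"])
qed

lemma has_field_derivative_partial_v:
  fixes F :: "real \<times> real \<Rightarrow> real"
  assumes "F differentiable (at (x, y))"
  shows "((\<lambda>t. F (x, t)) has_field_derivative partial_v F (x, y)) (at y)"
proof -
  have "((\<lambda>t. F (x, t)) has_derivative
      (\<lambda>h. fst (0::real, h) *\<^sub>R partial_u F (x, y) + snd (0::real, h) *\<^sub>R partial_v F (x, y))) (at y)"
    by (rule has_derivative_compose[where f = "\<lambda>t. (x, t)", OF _ has_derivative_partials[OF assms]])
      (auto intro!: derivative_eq_intros)
  then show ?thesis by (simp add: has_field_derivative_def mult.commute[of _ "partial_v F (x, y)"])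
qed

text \<open>The mean value theorem is applied twice: in the first variable to the difference of
  \<open>F\<close> along the two horizontal sides of the square, then in the second variable to
  \<open>partial_u F\<close> on the vertical segment over the intermediate point
  \<open>z\<close>.\<close>

lemma second_difference_mvt:
  fixes F :: "real \<times> real \<Rightarrow> real"
  assumes "s > 0" and sub: "{a..a+s} \<times> {b..b+s} \<subseteq> S"
    and F: "\<And>p. p \<in> S \<Longrightarrow> F differentiable (at p)"
    and Fu: "\<And>p. p \<in> S \<Longrightarrow> partial_u F differentiable (at p)"
  shows "\<exists>p \<in> {a..a+s} \<times> {b..b+s}.
    F (a+s, b+s) - F (a, b+s) - F (a+s, b) + F (a, b) = s * s * partial_v (partial_u F) p"
proof -
  have "\<exists>z>a. z < a+s \<and> (\<lambda>x. F (x, b+s) - F (x, b)) (a+s) - (\<lambda>x. F (x, b+s) - F (x, b)) a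
      = (a + s - a) * (partial_u F (z, b+s) - partial_u F (z, b))"
    using assms(1) sub
    by (intro MVT2) (auto intro!: DERIV_diff has_field_derivative_partial_u F)
  then obtain z where z: "a < z" "z < a+s"
    "F (a+s, b+s) - F (a+s, b) - (F (a, b+s) - F (a, b))
      = s * (partial_u F (z, b+s) - partial_u F (z, b))" by auto
  have "\<exists>w>b. w < b+s \<and> partial_u F (z, b+s) - partial_u F (z, b)
      = (b + s - b) * partial_v (partial_u F) (z, w)"
    using assms(1) sub z
    by (intro MVT2) (auto intro!: has_field_derivative_partial_v Fu)
  then obtain w where "b < w" "w < b+s"
    "partial_u F (z, b+s) - partial_u F (z, b) = s * partial_v (partial_u F) (z, w)" by auto
  with z show ?thesis by (intro bexI[of _ "(z, w)"]) (auto simp: algebra_simps)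
qed

text \<open>On a small square with corner \<open>p\<close>, one and the same second difference
  equals \<open>s * s\<close> times a value of either mixed partial. By continuity these values are
  close to \<open>A p\<close> and \<open>B p\<close>, so the two cannot differ.\<close>

lemma mixed_partials_commute_real:
  fixes F :: "real \<times> real \<Rightarrow> real"
  assumes S: "open S" and F: "smooth_on S F" and p: "p \<in> S"
  shows "partial_v (partial_u F) p = partial_u (partial_v F) p"
proof (rule ccontr)
  define A where "A = partial_v (partial_u F)"
  define B where "B = partial_u (partial_v F)"
  assume neq: "partial_v (partial_u F) p \<noteq> partial_u (partial_v F) p"
  \<comment> \<open>With half the gap as tolerance, a value within \<open>e\<close> of
    \<open>A p\<close> never equals a value within \<open>e\<close> of \<open>B p\<close>.\<close>
  define e where "e = \<bar>A p - B p\<bar> / 2"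
  have e: "e > 0" using neq by (simp add: e_def A_def B_def)
  have "smooth_on S A" "smooth_on S B"
    unfolding A_def B_def using F by (auto intro: smooth_on_partial_u smooth_on_partial_v)
  then have cont: "isCont A p" "isCont B p"
    using S p by (auto dest: smooth_on_continuous simp: continuous_on_eq_continuous_at)
  obtain d1 where d1: "d1 > 0" "\<And>x. dist x p < d1 \<Longrightarrow> dist (A x) (A p) < e"
    using cont(1) e unfolding continuous_at_eps_delta by blast
  obtain d2 where d2: "d2 > 0" "\<And>x. dist x p < d2 \<Longrightarrow> dist (B x) (B p) < e"
    using cont(2) e unfolding continuous_at_eps_delta by blast
  obtain d3 where d3: "d3 > 0" "\<And>x. dist x p < d3 \<Longrightarrow> x \<in> S"
    using S p unfolding open_dist by blast
  define d where "d = min d1 (min d2 d3)"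
  have d: "d > 0" "\<And>x. dist x p < d \<Longrightarrow> dist (A x) (A p) < e \<and> dist (B x) (B p) < e \<and> x \<in> S"
    using d1 d2 d3 by (auto simp: d_def)
  obtain a b where ab: "p = (a, b)" by (cases p)
  \<comment> \<open>With this side the two coordinate deviations add up to at most
    \<open>2 * d / 3\<close>, so the square lies in the ball of radius \<open>d\<close>.\<close>
  define s where "s = d / 3"
  have s: "s > 0" using d by (simp add: s_def)
  have near: "dist (x, y) p < d" if "x \<in> {a..a+s}" "y \<in> {b..b+s}" for x y
  proof -
    have "dist (x, y) p \<le> \<bar>x - a\<bar> + \<bar>y - b\<bar>"
      using sqrt_sum_squares_le_sum_abs[of "x - a" "y - b"]
      by (simp add: ab dist_Pair_Pair dist_real_def)
    also have "\<dots> < d" using that d(1) by (auto simp: s_def)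
    finally show ?thesis .
  qed
  have sub: "{a..a+s} \<times> {b..b+s} \<subseteq> S" using near d(2) by auto
  define R where "R = F (a+s, b+s) - F (a, b+s) - F (a+s, b) + F (a, b)"
  obtain x where x: "x \<in> {a..a+s} \<times> {b..b+s}" "R = s * s * A x"
    using second_difference_mvt[OF s sub, of F] F
    unfolding R_def A_def by (blast dest: smooth_on_differentiable smooth_on_partial_u)
  \<comment> \<open>The second difference is symmetric in the two variables. Applying the previous
    lemma to the reflected function therefore expresses the same \<open>R\<close> by the partials
    taken in the other order.\<close>
  define G where "G = (\<lambda>x. F (prod.swap x))"
  define T where "T = prod.swap ` S"
  have "T = prod.swap -` S" unfolding T_def by force
  then have T: "open T"
    using open_vimage[OF S linear_continuous_on[OF bounded_linear_swap]] by simp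
  have Gu: "partial_u G x = partial_v F (prod.swap x)" if "x \<in> T" for x
    unfolding G_def using that by (intro partial_u_swap) (auto simp: T_def smooth_on_differentiable[OF F])
  have Gd: "(\<lambda>x. partial_v F (prod.swap x)) differentiable (at x)" if "x \<in> T" for x
    using that
    by (intro differentiable_swap) (auto simp: T_def smooth_on_differentiable[OF smooth_on_partial_v[OF F]])
  have Gv: "partial_v (partial_u G) x = B (prod.swap x)" if "x \<in> T" for x
  proof -
    have "partial_v (partial_u G) x = partial_v (\<lambda>x. partial_v F (prod.swap x)) x"
      using partial_v_cong[OF T that Gd[OF that], of "partial_u G"] Gu by simp
    also have "\<dots> = B (prod.swap x)"
      unfolding B_def using that
      by (intro partial_v_swap) (auto simp: T_def smooth_on_differentiable[OF smooth_on_partial_v[OF F]])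
    finally show ?thesis .
  qed
  have subT: "{b..b+s} \<times> {a..a+s} \<subseteq> T" using sub by (force simp: T_def)
  have "\<exists>x \<in> {b..b+s} \<times> {a..a+s}.
     G (b+s, a+s) - G (b, a+s) - G (b+s, a) + G (b, a) = s * s * partial_v (partial_u G) x"
  proof (rule second_difference_mvt[OF s subT])
    fix x assume "x \<in> T"
    then show "G differentiable (at x)"
      unfolding G_def by (intro differentiable_swap) (auto simp: T_def smooth_on_differentiable[OF F])
    show "partial_u G differentiable (at x)"
      using differentiable_cong_open[OF T \<open>x \<in> T\<close> _ Gd[OF \<open>x \<in> T\<close>], of "partial_u G"] Gu by simp
  qed
  then obtain y where y: "y \<in> {b..b+s} \<times> {a..a+s}"
    "G (b+s, a+s) - G (b, a+s) - G (b+s, a) + G (b, a) = s * s * partial_v (partial_u G) y"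
    by blast
  then have "R = s * s * B (prod.swap y)"
    using Gv[of y] subT by (auto simp: G_def R_def)
  with x s have "A x = B (prod.swap y)" by auto
  moreover have "dist (A x) (A p) < e" using x near d(2) by auto
  moreover have "dist (B (prod.swap y)) (B p) < e" using y near d(2) by auto
  ultimately show False unfolding e_def dist_real_def by (simp add: field_simps abs_if split: if_splits)
qed

text \<open>Taking a component is bounded linear and hence commutes with both partials, which
  reduces the claim to real-valued functions.\<close>

lemma mixed_partials_commute:
  fixes F :: "real \<times> real \<Rightarrow> real^'n"
  assumes S: "open S" and F: "smooth_on S F" and p: "p \<in> S"
  shows "partial_v (partial_u F) p = partial_u (partial_v F) p"
proof (subst vec_eq_iff, rule allI)
  fix i
  have nth: "partial_u (\<lambda>x. H x $ i) p = partial_u H p $ i \<and>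
    partial_v (\<lambda>x. H x $ i) p = partial_v H p $ i" if "H differentiable (at p)"
    for p and H :: "real \<times> real \<Rightarrow> real^'n"
    using partial_eqI[OF bounded_linear.has_derivative[OF bounded_linear_vec_nth
          has_derivative_partials[OF that], of i]] by simp
  have Fu: "smooth_on S (partial_u F)" and Fv: "smooth_on S (partial_v F)"
    using F by (auto intro: smooth_on_partial_u smooth_on_partial_v)
  have Fi: "smooth_on S (\<lambda>x. F x $ i)" by (rule smooth_on_vec_nth[OF S F])
  have "partial_v (partial_u F) p $ i = partial_v (\<lambda>x. partial_u F x $ i) p"
    using nth smooth_on_differentiable[OF Fu p] by simp
  also have "\<dots> = partial_v (partial_u (\<lambda>x. F x $ i)) p"
    by (intro partial_v_cong[OF S p] smooth_on_differentiable[OF smooth_on_vec_nth[OF S Fu] p])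
      (use nth smooth_on_differentiable[OF F] in simp)
  also have "\<dots> = partial_u (partial_v (\<lambda>x. F x $ i)) p"
    by (rule mixed_partials_commute_real[OF S Fi p])
  also have "\<dots> = partial_u (\<lambda>x. partial_v F x $ i) p"
    by (intro partial_u_cong[OF S p] smooth_on_differentiable[OF smooth_on_partial_v[OF Fi] p])
      (use nth smooth_on_differentiable[OF F] in simp)
  also have "\<dots> = partial_u (partial_v F) p $ i"
    using nth smooth_on_differentiable[OF Fv p] by simp
  finally show "partial_v (partial_u F) p $ i = partial_u (partial_v F) p $ i" .
qed

section \<open>Minkowski space\<close>

lemma bounded_bilinear_minkowski: "bounded_bilinear minkowski"
  unfolding bilinear_conv_bounded_bilinear[symmetric] bilinear_def
  by (auto intro!: linearI simp: minkowski_def algebra_simps)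

lemma minkowski_commute: "minkowski x y = minkowski y x"
  by (simp add: minkowski_def mult.commute)

text \<open>The determinant \<open>d\<close> of \<open>x\<close>, \<open>y\<close>, \<open>n\<close>
  satisfies \<open>d\<^sup>2 = (minkowski x y)\<^sup>2\<close>, because the metric has determinant
  -1. So the three vectors form a basis, and only zero is orthogonal to a basis.\<close>

lemma null_frame_nondegenerate:
  assumes xx: "minkowski x x = 0" and yy: "minkowski y y = 0" and xy: "minkowski x y \<noteq> 0"
    and nn: "minkowski n n = 1" and xn: "minkowski x n = 0" and yn: "minkowski y n = 0"
    and w: "minkowski w x = 0" "minkowski w y = 0" "minkowski w n = 0"
  shows "w = 0"
proof -
  define d where "d = x$1 * (y$2 * n$3 - y$3 * n$2) - x$2 * (y$1 * n$3 - y$3 * n$1)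
    + x$3 * (y$1 * n$2 - y$2 * n$1)"
  \<comment> \<open>minus the Gram determinant of \<open>x, y, n\<close>\<close>
  have "d\<^sup>2 = - (minkowski x x * (minkowski y y * minkowski n n - (minkowski y n)\<^sup>2)
    - minkowski x y * (minkowski x y * minkowski n n - minkowski y n * minkowski x n)
    + minkowski x n * (minkowski x y * minkowski y n - minkowski y y * minkowski x n))"
    unfolding d_def minkowski_def by algebra
  also have "\<dots> = (minkowski x y)\<^sup>2"
    by (simp add: xx nn xn yn power2_eq_square)
  finally have d: "d \<noteq> 0" using xy by auto
  \<comment> \<open>Cramer's rule for the linear system given by the three products with
    \<open>w\<close>. The sign in the first equation is that of the metric on the first
    coordinate.\<close>
  have "- (d * w$1) = minkowski w x * (y$2 * n$3 - y$3 * n$2)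
    + minkowski w y * (n$2 * x$3 - n$3 * x$2) + minkowski w n * (x$2 * y$3 - x$3 * y$2)"
    "d * w$2 = minkowski w x * (y$3 * n$1 - y$1 * n$3)
    + minkowski w y * (n$3 * x$1 - n$1 * x$3) + minkowski w n * (x$3 * y$1 - x$1 * y$3)"
    "d * w$3 = minkowski w x * (y$1 * n$2 - y$2 * n$1)
    + minkowski w y * (n$1 * x$2 - n$2 * x$1) + minkowski w n * (x$1 * y$2 - x$2 * y$1)"
    unfolding d_def minkowski_def by algebra+
  then show ?thesis using d w by (simp add: vec_eq_iff forall_3)
qed

section \<open>From the formulas to a minimal surface\<close>

text \<open>The primitive is the integral from a fixed base point \<open>c\<close>, which may lie on
  either side of \<open>x\<close>.\<close>

lemma antiderivative_on_interval:
  fixes f :: "real \<Rightarrow> 'a::euclidean_space"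
  assumes I: "open I" "connected I" and f: "continuous_on I f"
  obtains F where "\<And>x. x \<in> I \<Longrightarrow> (F has_vector_derivative f x) (at x)"
proof (cases "I = {}")
  case True
  then show ?thesis using that by blast
next
  case False
  then obtain c where c: "c \<in> I" by blast
  have "((\<lambda>u. LBINT y=c..u. f y) has_vector_derivative f x) (at x)" if x: "x \<in> I" for x
  proof -
    obtain e where e: "e > 0" "cball x e \<subseteq> I"
      using I(1) x open_contains_cball by blast
    \<comment> \<open>The interval from \<open>a\<close> to \<open>b\<close> contains
      \<open>c\<close> and has \<open>x\<close> in its interior. Its endpoints lie in
      \<open>I\<close>, so connectedness puts all of it into \<open>I\<close>, and the derivative
      within it is the full derivative at \<open>x\<close>.\<close>
    define a b where "a = min c (x - e)" and "b = max c (x + e)"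
    have "x - e \<in> I" "x + e \<in> I" using e by (auto simp: subset_iff dist_real_def)
    then have "a \<in> I" "b \<in> I" using c by (auto simp: a_def b_def min_def max_def)
    then have sub: "{a..b} \<subseteq> I" using I(2) connected_contains_Icc by blast
    have ab: "a < x" "x < b" "a \<le> c" "c \<le> b" using e by (auto simp: a_def b_def)
    have "((\<lambda>u. LBINT y=c..u. f y) has_vector_derivative f x) (at x within {a..b})"
      using ab by (intro interval_integral_FTC2 continuous_on_subset[OF f sub]) auto
    then have "((\<lambda>u. LBINT y=c..u. f y) has_vector_derivative f x) (at x within {a<..<b})"
      by (rule has_vector_derivative_within_subset) auto
    then show ?thesis
      using ab has_vector_derivative_within_open[of x "{a<..<b}"] by auto
  qed
  then show ?thesis using that by blast
qed

text \<open>A slice \<open>i\<close> stays in the open set \<open>S\<close> near \<open>t\<close>,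
  so \<open>k\<close> agrees there with the continuous composite of \<open>h\<close> and
  \<open>i\<close>. This carries continuity from functions on \<open>M\<close> to their one-variable
  profiles.\<close>

lemma isCont_factor:
  fixes h :: "'a::t2_space \<Rightarrow> 'b::t2_space" and i :: "'c::t2_space \<Rightarrow> 'a"
  assumes "open S" "continuous_on S h" "isCont i t" "i t \<in> S"
    and eq: "\<And>s. i s \<in> S \<Longrightarrow> h (i s) = k s"
  shows "isCont k t"
proof -
  have "isCont h (i t)" using assms by (simp add: continuous_on_eq_continuous_at)
  then have "isCont (\<lambda>s. h (i s)) t" using assms(3) by (rule isCont_o2[rotated])
  moreover have "\<forall>\<^sub>F s in nhds t. h (i s) = k s"
  proof -
    have "\<forall>\<^sub>F s in nhds t. i s \<in> S"
      using assms(1,3,4) by (metis isCont_def tendsto_at_iff_tendsto_nhds topological_tendstoD)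
    then show ?thesis by eventually_elim (rule eq)
  qed
  ultimately show ?thesis using isCont_cong[of "\<lambda>s. h (i s)" k t] by simp
qed

text \<open>Both projections of \<open>M\<close> are open and connected, hence intervals, and carry
  the one-variable profiles. Primitives taken on these intervals give a solution on all of
  \<open>M\<close>, whatever the shape of \<open>M\<close>.\<close>

lemma weierstrass_formulas_integrable:
  assumes M: "open M" "connected M"
    and cont: "continuous_on M q" "continuous_on M r" "continuous_on M f" "continuous_on M g"
    and dep: "function_of_u M q" "function_of_v M r" "function_of_u M f" "function_of_v M g"
  shows "\<exists>\<phi>. weierstrass_formulas M q r f g \<phi>"
proof -
  define X where "X = (\<lambda>f q. f *\<^sub>R (vector [(1 + q\<^sup>2) / 2, - ((1 - q\<^sup>2) / 2), - q] :: real^3))"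
  define Y where "Y = (\<lambda>g r. g *\<^sub>R (vector [- ((1 + r\<^sup>2) / 2), - ((1 - r\<^sup>2) / 2), - r] :: real^3))"
  have contX: "continuous_on M (\<lambda>p. X (f p) (q p))" and contY: "continuous_on M (\<lambda>p. Y (g p) (r p))"
  proof -
    have v: "(vector [a, b, c] :: real^3) = a *\<^sub>R axis 1 1 + b *\<^sub>R axis 2 1 + c *\<^sub>R axis 3 1"
      for a b c :: real by (simp add: vec_eq_iff forall_3 axis_def)
    show "continuous_on M (\<lambda>p. X (f p) (q p))" "continuous_on M (\<lambda>p. Y (g p) (r p))"
      unfolding X_def Y_def v by (intro continuous_intros cont; simp)+
  qed
  obtain kq kf where k: "\<And>u v. (u, v) \<in> M \<Longrightarrow> q (u, v) = kq u" "\<And>u v. (u, v) \<in> M \<Longrightarrow> f (u, v) = kf u"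
    using dep unfolding function_of_u_def by blast
  obtain kr kg where l: "\<And>u v. (u, v) \<in> M \<Longrightarrow> r (u, v) = kr v" "\<And>u v. (u, v) \<in> M \<Longrightarrow> g (u, v) = kg v"
    using dep unfolding function_of_v_def by blast
  \<comment> \<open>Continuity at \<open>u\<close> is tested along the horizontal slice through any
    point of \<open>M\<close> with first coordinate \<open>u\<close>.\<close>
  have "isCont (\<lambda>u. X (kf u) (kq u)) u" if "(u, v) \<in> M" for u v
    using that k
    by (intro isCont_factor[OF M(1) contX, where i = "\<lambda>t. (t, v)" and k = "\<lambda>u. X (kf u) (kq u)"]) auto
  then have cA: "continuous_on (fst ` M) (\<lambda>u. X (kf u) (kq u))"
    by (auto intro!: continuous_at_imp_continuous_on)
  have "isCont (\<lambda>v. Y (kg v) (kr v)) v" if "(u, v) \<in> M" for u v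
    using that l
    by (intro isCont_factor[OF M(1) contY, where i = "\<lambda>t. (u, t)" and k = "\<lambda>v. Y (kg v) (kr v)"]) auto
  then have cB: "continuous_on (snd ` M) (\<lambda>v. Y (kg v) (kr v))"
    by (auto intro!: continuous_at_imp_continuous_on)
  have "connected (fst ` M)" "connected (snd ` M)"
    using M(2) by (auto intro!: connected_continuous_image continuous_intros)
  then obtain A B where
    A: "\<And>u. u \<in> fst ` M \<Longrightarrow> (A has_vector_derivative X (kf u) (kq u)) (at u)" and
    B: "\<And>v. v \<in> snd ` M \<Longrightarrow> (B has_vector_derivative Y (kg v) (kr v)) (at v)"
    using antiderivative_on_interval[OF open_image_fst[OF M(1)] _ cA]
      antiderivative_on_interval[OF open_image_snd[OF M(1)] _ cB] by metis
  have "((\<lambda>p. A (fst p) + B (snd p)) has_derivative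
      (\<lambda>h. fst h *\<^sub>R X (f p) (q p) + snd h *\<^sub>R Y (g p) (r p))) (at p)" if p: "p \<in> M" for p
  proof -
    have "f p = kf (fst p)" "q p = kq (fst p)" "g p = kg (snd p)" "r p = kr (snd p)"
      using k[of "fst p" "snd p"] l[of "fst p" "snd p"] p by auto
    then have "(A has_derivative (\<lambda>h. h *\<^sub>R X (f p) (q p))) (at (fst p))"
      "(B has_derivative (\<lambda>h. h *\<^sub>R Y (g p) (r p))) (at (snd p))"
      using A[of "fst p"] B[of "snd p"] p by (auto simp: has_vector_derivative_def)
    then show ?thesis
      by (intro has_derivative_add has_derivative_compose[where f = fst and g = A]
          has_derivative_compose[where f = snd and g = B])
        (auto intro!: derivative_eq_intros)
  qed
  note D = this
  have "weierstrass_formulas M q r f g (\<lambda>p. A (fst p) + B (snd p))"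
    unfolding weierstrass_formulas_def
  proof (intro ballI conjI)
    fix p assume p: "p \<in> M"
    show "(\<lambda>p. A (fst p) + B (snd p)) differentiable at p"
      using D[OF p] differentiable_def by blast
  qed (simp_all add: partial_eqI[OF D] X_def Y_def)
  then show ?thesis by blast
qed

section \<open>Induced metric, unit normal and minimality of the surface\<close>

lemma weierstrass_formulasD:
  assumes "weierstrass_formulas M q r f g \<phi>" "p \<in> M"
  shows "\<phi> differentiable (at p)"
    "partial_u \<phi> p = f p *\<^sub>R vector [(1 + (q p)\<^sup>2) / 2, - ((1 - (q p)\<^sup>2) / 2), - q p]"
    "partial_v \<phi> p = g p *\<^sub>R vector [- ((1 + (r p)\<^sup>2) / 2), - ((1 - (r p)\<^sup>2) / 2), - r p]"
  using assms unfolding weierstrass_formulas_def by auto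

text \<open>Both partials are null, so only the cross terms survive. The polar form is recorded
  because injectivity, the null conditions and the Lorentzian frame require products of different
  tangent vectors.\<close>

lemma weierstrass_induced_metric:
  assumes "weierstrass_formulas M q r f g \<phi>" "p \<in> M"
  shows "induced_metric \<phi> p (a, b) (c, d) =
    (1 + q p * r p)\<^sup>2 * f p * g p / 2 * (a * d + b * c)"
proof -
  note W = weierstrass_formulasD[OF assms]
  show ?thesis
    unfolding induced_metric_def frechet_derivative_partials[OF W(1)] W(2,3) minkowski_def
    by (simp add: field_simps power2_eq_square)
qed

text \<open>Every directional derivative is a combination of the two partials with constant
  coefficients. The formulas prescribe the partials, so a merely differentiable solution turns out
  smooth.\<close>

lemma smooth_on_of_partials:
  assumes "open S" "\<And>p. p \<in> S \<Longrightarrow> F differentiable (at p)"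
    and "smooth_on S (partial_u F)" "smooth_on S (partial_v F)"
  shows "smooth_on S F"
proof (rule smooth_onI_frechet)
  fix h :: "real \<times> real"
  have "smooth_on S (\<lambda>p. fst h *\<^sub>R partial_u F p + snd h *\<^sub>R partial_v F p)"
    using assms by (intro smooth_on_intros)
  then show "smooth_on S (\<lambda>p. frechet_derivative F (at p) h)"
    by (rule smooth_on_cong[OF assms(1)]) (metis assms(2) frechet_derivative_partials prod.collapse)
qed (use assms in blast)

text \<open>Positivity makes the logarithm an admissible exponent of the metric and keeps
  \<open>1 + q p * r p\<close> away from zero, as the unit normal requires.\<close>

lemma weierstrass_minimal:
  assumes M: "open M"
    and hol: "lorentz_holomorphic M q" "lorentz_holomorphic M f"
    and ahol: "lorentz_antiholomorphic M r" "lorentz_antiholomorphic M g"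
    and W: "weierstrass_formulas M q r f g \<phi>"
    and pos: "\<And>p. p \<in> M \<Longrightarrow> 0 < (1 + q p * r p)\<^sup>2 * f p * g p"
  shows "timelike_minimal_surface M \<phi> (\<lambda>p. ln ((1 + q p * r p)\<^sup>2 * f p * g p))"
proof -
  have sm: "smooth_on M q" "smooth_on M f" "smooth_on M r" "smooth_on M g"
    and qv: "\<And>p. p \<in> M \<Longrightarrow> partial_v q p = 0" and fv: "\<And>p. p \<in> M \<Longrightarrow> partial_v f p = 0"
    using hol ahol unfolding lorentz_holomorphic_def lorentz_antiholomorphic_def by auto
  define E where "E = (\<lambda>p. (1 + q p * r p)\<^sup>2 * f p * g p)"
  have E: "E p > 0" if "p \<in> M" for p using pos[OF that] by (simp add: E_def)
  have ne: "1 + q p * r p \<noteq> 0" if "p \<in> M" for p using pos[OF that] by auto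
  note Wp = weierstrass_formulasD[OF W]
  have met: "induced_metric \<phi> p (a, b) (c, d) = E p / 2 * (a * d + b * c)" if "p \<in> M" for p a b c d
    using weierstrass_induced_metric[OF W that] by (simp add: E_def)
  have mets: "minkowski (frechet_derivative \<phi> (at p) (a, b)) (frechet_derivative \<phi> (at p) (c, d))
    = E p / 2 * (a * d + b * c)" if "p \<in> M" for p a b c d
    using met[OF that] by (simp add: induced_metric_def)
  have "smooth_on M (\<lambda>p. f p *\<^sub>R (vector [(1 + (q p)\<^sup>2) / 2, - ((1 - (q p)\<^sup>2) / 2), - q p] :: real^3))"
    "smooth_on M (\<lambda>p. g p *\<^sub>R (vector [- ((1 + (r p)\<^sup>2) / 2), - ((1 - (r p)\<^sup>2) / 2), - r p] :: real^3))"
    using M sm by (auto intro!: smooth_on_intros)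
  then have smp: "smooth_on M (partial_u \<phi>)" "smooth_on M (partial_v \<phi>)"
    using Wp by (auto intro: smooth_on_cong[OF M])
  have sphi: "smooth_on M \<phi>"
    using smooth_on_of_partials[OF M Wp(1) smp] .
  have timelike: "timelike_surface M \<phi>"
    unfolding timelike_surface_def
  proof (intro conjI ballI sphi)
    fix p assume p: "p \<in> M"
    have lin: "linear (frechet_derivative \<phi> (at p))"
      by (rule linear_frechet_derivative[OF Wp(1)[OF p]])
    show "inj (frechet_derivative \<phi> (at p))"
      unfolding linear_injective_0[OF lin]
    proof (intro allI impI)
      fix X assume "frechet_derivative \<phi> (at p) X = 0"
      then have "minkowski (frechet_derivative \<phi> (at p) (fst X, snd X)) v = 0" for v
        by (simp add: minkowski_def)
      \<comment> \<open>The product with \<open>\<phi>\<^sub>v\<close> reads off the first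
        coordinate of \<open>X\<close>, that with \<open>\<phi>\<^sub>u\<close> the second, each
        multiplied by \<open>E p / 2\<close>.\<close>
      from this[of "frechet_derivative \<phi> (at p) (0, 1)"] this[of "frechet_derivative \<phi> (at p) (1, 0)"]
      show "X = 0" unfolding mets[OF p] using E[OF p] by (simp add: prod_eq_iff)
    qed
    show "lorentzian_form (induced_metric \<phi> p)"
      unfolding lorentzian_form_def
      \<comment> \<open>The quadratic form is \<open>E p\<close> times the product of the two
        coordinates: negative on the antidiagonal and positive on the diagonal. The witnesses are
        these directions, normalised.\<close>
      by (rule exI[of _ "(1 / sqrt (E p), - 1 / sqrt (E p))"], rule exI[of _ "(1 / sqrt (E p), 1 / sqrt (E p))"])
        (use E[OF p] in \<open>simp add: met[OF p] field_simps\<close>)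
  qed
  have null: "null_coordinates M \<phi> (\<lambda>p. ln (E p))"
    using E by (simp add: null_coordinates_def partial_u_def partial_v_def mets)
  \<comment> \<open>This is the Lorentzian cross product of the two vectors in the formulas with the
    common factor \<open>(1 + q p * r p) / 2\<close> removed.\<close>
  define n :: "real \<times> real \<Rightarrow> real^3" where
    "n = (\<lambda>p. vector [q p - r p, q p + r p, q p * r p - 1])"
  define N where "N = (\<lambda>p. (1 / (1 + q p * r p)) *\<^sub>R n p)"
  have "unit_normal_field M \<phi> N"
    unfolding unit_normal_field_def
  proof (intro conjI ballI allI)
    show "smooth_on M N" unfolding N_def n_def
      using M sm ne by (intro smooth_on_intros) auto
    fix p assume p: "p \<in> M"
    note bil = bounded_bilinear.scaleR_left[OF bounded_bilinear_minkowski]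
      bounded_bilinear.scaleR_right[OF bounded_bilinear_minkowski]
      bounded_bilinear.add_left[OF bounded_bilinear_minkowski]
    have "minkowski (n p) (n p) = (1 + q p * r p) * (1 + q p * r p)"
      by (simp add: n_def minkowski_def algebra_simps)
    then show "minkowski (N p) (N p) = 1" using ne[OF p]
      by (simp add: N_def bil)
    have "minkowski (partial_u \<phi> p) (n p) = 0" "minkowski (partial_v \<phi> p) (n p) = 0"
      unfolding n_def minkowski_def Wp(2,3)[OF p]
      by (simp_all add: field_simps power2_eq_square)
    then show "minkowski (frechet_derivative \<phi> (at p) X) (N p) = 0" for X
      by (cases X) (simp add: N_def frechet_derivative_partials[OF Wp(1)[OF p]] bil)
  qed
  moreover have "mean_curvature \<phi> \<omega> N p = 0" if p: "p \<in> M" for p \<omega>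
  proof -
    \<comment> \<open>The derivative of this curve is never computed: since \<open>q\<close> has
      zero derivative in direction \<open>v\<close>, the chain rule only evaluates \<open>W'\<close>
      at 0.\<close>
    define W :: "real \<Rightarrow> real^3" where
      "W = (\<lambda>t. ((1 + t\<^sup>2) / 2) *\<^sub>R axis 1 1 + (- ((1 - t\<^sup>2) / 2)) *\<^sub>R axis 2 1 + (- t) *\<^sub>R axis 3 1)"
    have X: "partial_u \<phi> x = f x *\<^sub>R W (q x)" if "x \<in> M" for x
      unfolding Wp(2)[OF that] by (simp add: W_def vec_eq_iff forall_3 axis_def)
    have fD: "(f has_derivative frechet_derivative f (at p)) (at p)"
      and qD: "(q has_derivative frechet_derivative q (at p)) (at p)"
      using sm p by (auto simp: frechet_derivative_works[symmetric] smooth_on_differentiable)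
    have f0: "frechet_derivative f (at p) (0, 1) = 0" and q0: "frechet_derivative q (at p) (0, 1) = 0"
      using qv[OF p] fv[OF p] by (auto simp: partial_v_def)
    have "W differentiable (at (q p))"
      unfolding W_def by (intro derivative_intros) auto
    then obtain W' where W': "(W has_derivative W') (at (q p))"
      by (auto simp: differentiable_def)
    have "W' 0 = 0" using has_derivative_linear[OF W'] by (rule linear_0)
    then have "partial_v (\<lambda>x. f x *\<^sub>R W (q x)) p = 0"
      using partial_v_eqI[OF has_derivative_scaleR[OF fD has_derivative_compose[OF qD W']]]
      by (simp add: f0 q0)
    then have "partial_v (partial_u \<phi>) p = 0"
      using partial_v_cong[OF M p smooth_on_differentiable[OF smp(1) p] X] by simp
    then show ?thesis by (simp add: mean_curvature_def minkowski_def)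
  qed
  ultimately show ?thesis
    unfolding timelike_minimal_surface_def using timelike null E_def by blast
qed

section \<open>From a minimal surface to the formulas\<close>

lemma minkowski_derivative:
  assumes "X differentiable (at p)"
  shows "frechet_derivative (\<lambda>p. minkowski (X p) (X p)) (at p) h
    = 2 * minkowski (frechet_derivative X (at p) h) (X p)"
proof -
  have X: "(X has_derivative frechet_derivative X (at p)) (at p)"
    using assms by (simp add: frechet_derivative_works)
  show ?thesis
    using frechet_derivative_eqI[OF bounded_bilinear.FDERIV[OF bounded_bilinear_minkowski X X]]
    by (simp add: minkowski_commute)
qed

text \<open>The function \<open>minkowski (X x) (X x)\<close> is constant near \<open>p\<close>, and
  its derivative is twice the product in question.\<close>

lemma minkowski_null_derivative:
  assumes S: "open S" "p \<in> S" and X: "X differentiable (at p)"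
    and null: "\<And>x. x \<in> S \<Longrightarrow> minkowski (X x) (X x) = 0"
  shows "minkowski (frechet_derivative X (at p) h) (X p) = 0"
proof -
  have "frechet_derivative (\<lambda>p. 0::real) (at p) = frechet_derivative (\<lambda>p. minkowski (X p) (X p)) (at p)"
    using S null by (intro frechet_derivative_cong_open) auto
  with minkowski_derivative[OF X, of h] show ?thesis by (metis frechet_derivative_const mult_eq_0_iff zero_neq_numeral)
qed

lemma minimal_surface_mixed_partials_eq_0:
  assumes M: "open M" and min: "timelike_minimal_surface M \<phi> \<omega>" and p: "p \<in> M"
  shows "partial_v (partial_u \<phi>) p = 0" and "partial_u (partial_v \<phi>) p = 0"
proof -
  from min obtain N where sm: "smooth_on M \<phi>" and null: "null_coordinates M \<phi> \<omega>"
    and N: "unit_normal_field M \<phi> N" and H: "\<And>p. p \<in> M \<Longrightarrow> mean_curvature \<phi> \<omega> N p = 0"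
    unfolding timelike_minimal_surface_def timelike_surface_def by blast
  have com: "partial_v (partial_u \<phi>) p = partial_u (partial_v \<phi>) p"
    by (rule mixed_partials_commute[OF M sm p])
  have du: "partial_u \<phi> differentiable (at p)" and dv: "partial_v \<phi> differentiable (at p)"
    using smooth_on_differentiable[OF smooth_on_partial_u[OF sm] p]
      smooth_on_differentiable[OF smooth_on_partial_v[OF sm] p] by auto
  show "partial_v (partial_u \<phi>) p = 0"
  proof (rule null_frame_nondegenerate)
    show "minkowski (partial_u \<phi> p) (partial_u \<phi> p) = 0" "minkowski (partial_v \<phi> p) (partial_v \<phi> p) = 0"
      "minkowski (partial_u \<phi> p) (partial_v \<phi> p) \<noteq> 0"
      using null p by (auto simp: null_coordinates_def)
    show "minkowski (N p) (N p) = 1" "minkowski (partial_u \<phi> p) (N p) = 0" "minkowski (partial_v \<phi> p) (N p) = 0"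
      using N p by (auto simp: unit_normal_field_def partial_u_def partial_v_def)
    show "minkowski (partial_v (partial_u \<phi>) p) (partial_u \<phi> p) = 0"
      unfolding partial_v_def using null
      by (intro minkowski_null_derivative[OF M p du]) (auto simp: null_coordinates_def)
    \<comment> \<open>By symmetry the mixed derivative is also the \<open>u\<close>-derivative of
      the null field \<open>\<phi>\<^sub>v\<close>, hence orthogonal to it.\<close>
    show "minkowski (partial_v (partial_u \<phi>) p) (partial_v \<phi> p) = 0"
      unfolding com unfolding partial_u_def using null
      by (intro minkowski_null_derivative[OF M p dv]) (auto simp: null_coordinates_def)
    show "minkowski (partial_v (partial_u \<phi>) p) (N p) = 0"
      using H[OF p] by (simp add: mean_curvature_def)
  qed
  with com show "partial_u (partial_v \<phi>) p = 0" by simp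
qed

section \<open>Recovering the data, uniquely up to translation\<close>

lemma partials_eq_imp_translate:
  fixes F G :: "real \<times> real \<Rightarrow> 'a::real_normed_vector"
  assumes "open S" "connected S"
    and "\<And>p. p \<in> S \<Longrightarrow> F differentiable (at p)" "\<And>p. p \<in> S \<Longrightarrow> G differentiable (at p)"
    and "\<And>p. p \<in> S \<Longrightarrow> partial_u F p = partial_u G p" "\<And>p. p \<in> S \<Longrightarrow> partial_v F p = partial_v G p"
  shows "\<exists>c. \<forall>p\<in>S. F p = G p + c"
proof (cases "S = {}")
  case False
  then obtain x where x: "x \<in> S" by blast
  have D: "((\<lambda>p. F p - G p) has_derivative (\<lambda>h. 0)) (at p)" if "p \<in> S" for p
    using has_derivative_diff[OF has_derivative_partials[OF assms(3)[OF that]]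
        has_derivative_partials[OF assms(4)[OF that]]] assms(5,6)[OF that] by simp
  have "F p - G p = F x - G x" if "p \<in> S" for p
    by (rule has_derivative_zero_unique_connected[OF assms(1,2) D that x])
  then have "\<forall>p\<in>S. F p = G p + (F x - G x)" by (metis add.commute diff_add_cancel)
  then show ?thesis by blast
qed simp

text \<open>The conditions \<open>ne\<close> say that the denominators \<open>f\<close> and
  \<open>g\<close> have no zero. The vanishing mixed partials make the data functions of the right
  kind, and the null conditions supply the quadratic terms in \<open>q\<close> and
  \<open>r\<close>.\<close>

lemma weierstrass_representableI:
  assumes S: "open S" "connected S" and sm: "smooth_on S \<phi>"
    and mixed: "\<And>p. p \<in> S \<Longrightarrow> partial_v (partial_u \<phi>) p = 0" "\<And>p. p \<in> S \<Longrightarrow> partial_u (partial_v \<phi>) p = 0"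
    and null: "\<And>p. p \<in> S \<Longrightarrow> minkowski (partial_u \<phi> p) (partial_u \<phi> p) = 0"
      "\<And>p. p \<in> S \<Longrightarrow> minkowski (partial_v \<phi> p) (partial_v \<phi> p) = 0"
    and ne: "\<And>p. p \<in> S \<Longrightarrow> partial_u \<phi> p $ 1 \<noteq> partial_u \<phi> p $ 2"
      "\<And>p. p \<in> S \<Longrightarrow> partial_v \<phi> p $ 1 \<noteq> - partial_v \<phi> p $ 2"
  shows "weierstrass_representable S \<phi>"
proof -
  note smu = smooth_on_partial_u[OF sm] and smv = smooth_on_partial_v[OF sm]
  \<comment> \<open>Solving the formulas: the first two components of \<open>\<phi>\<^sub>u\<close>
    have difference \<open>f\<close>, those of \<open>\<phi>\<^sub>v\<close> have sum
    \<open>- g\<close>, and the third components are \<open>- f q\<close> and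
    \<open>- g r\<close>.\<close>
  define f where "f = (\<lambda>p. partial_u \<phi> p $ 1 - partial_u \<phi> p $ 2)"
  define q where "q = (\<lambda>p. - partial_u \<phi> p $ 3 / f p)"
  define g where "g = (\<lambda>p. - (partial_v \<phi> p $ 1 + partial_v \<phi> p $ 2))"
  define r where "r = (\<lambda>p. - partial_v \<phi> p $ 3 / g p)"
  have f0: "f p \<noteq> 0" and g0: "g p \<noteq> 0" if "p \<in> S" for p
    using ne[OF that] by (auto simp: f_def g_def)
  have sf: "smooth_on S f" unfolding f_def by (intro smooth_on_intros S smu)
  have sg: "smooth_on S g" unfolding g_def by (intro smooth_on_intros S smv)
  have sq: "smooth_on S q" unfolding q_def by (intro smooth_on_intros S smu sf f0)
  have sr: "smooth_on S r" unfolding r_def by (intro smooth_on_intros S smv sg g0)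
  have "partial_v f p = 0 \<and> partial_v q p = 0" if p: "p \<in> S" for p
  proof -
    define D where "D = frechet_derivative (partial_u \<phi>) (at p)"
    have "(partial_u \<phi> has_derivative D) (at p)" and D0: "D (0, 1) = 0"
      using smooth_on_differentiable[OF smu p] mixed(1)[OF p]
      by (auto simp: D_def frechet_derivative_works partial_v_def)
    then have nth: "((\<lambda>p. partial_u \<phi> p $ i) has_derivative (\<lambda>h. D h $ i)) (at p)" for i
      using bounded_linear.has_derivative[OF bounded_linear_vec_nth] by blast
    have fD: "(f has_derivative (\<lambda>h. D h $ 1 - D h $ 2)) (at p)"
      unfolding f_def by (intro has_derivative_diff nth)
    show ?thesis
      using partial_v_eqI[OF fD] f0[OF p] D0
        partial_v_eqI[OF has_derivative_divide'[OF has_derivative_minus[OF nth[of 3]] fD]]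
      by (simp add: q_def)
  qed
  then have hol: "lorentz_holomorphic S q" "lorentz_holomorphic S f"
    using sq sf by (auto simp: lorentz_holomorphic_def)
  have "partial_u g p = 0 \<and> partial_u r p = 0" if p: "p \<in> S" for p
  proof -
    define D where "D = frechet_derivative (partial_v \<phi>) (at p)"
    have "(partial_v \<phi> has_derivative D) (at p)" and D0: "D (1, 0) = 0"
      using smooth_on_differentiable[OF smv p] mixed(2)[OF p]
      by (auto simp: D_def frechet_derivative_works partial_u_def)
    then have nth: "((\<lambda>p. partial_v \<phi> p $ i) has_derivative (\<lambda>h. D h $ i)) (at p)" for i
      using bounded_linear.has_derivative[OF bounded_linear_vec_nth] by blast
    have gD: "(g has_derivative (\<lambda>h. - (D h $ 1 + D h $ 2))) (at p)"
      unfolding g_def by (intro has_derivative_minus has_derivative_add nth)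
    show ?thesis
      using partial_u_eqI[OF gD] g0[OF p] D0
        partial_u_eqI[OF has_derivative_divide'[OF has_derivative_minus[OF nth[of 3]] gD]]
      by (simp add: r_def)
  qed
  then have ahol: "lorentz_antiholomorphic S r" "lorentz_antiholomorphic S g"
    using sr sg by (auto simp: lorentz_antiholomorphic_def)
  have W: "weierstrass_formulas S q r f g \<phi>"
    unfolding weierstrass_formulas_def
  proof (intro ballI conjI)
    fix p assume p: "p \<in> S"
    show "\<phi> differentiable at p" by (rule smooth_on_differentiable[OF sm p])
    have "(partial_u \<phi> p $ 3)\<^sup>2 = f p * (partial_u \<phi> p $ 1 + partial_u \<phi> p $ 2)"
      using null(1)[OF p] by (simp add: minkowski_def f_def power2_eq_square algebra_simps)
    then have "f p * (q p)\<^sup>2 = partial_u \<phi> p $ 1 + partial_u \<phi> p $ 2" "f p * q p = - partial_u \<phi> p $ 3"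
      using f0[OF p] by (simp_all add: q_def power_divide, simp add: power2_eq_square)
    then show "partial_u \<phi> p = f p *\<^sub>R vector [(1 + (q p)\<^sup>2) / 2, - ((1 - (q p)\<^sup>2) / 2), - q p]"
      by (simp add: vec_eq_iff forall_3 distrib_left right_diff_distrib) (simp add: f_def)
    have "(partial_v \<phi> p $ 3)\<^sup>2 = g p * (partial_v \<phi> p $ 2 - partial_v \<phi> p $ 1)"
      using null(2)[OF p] by (simp add: minkowski_def g_def power2_eq_square algebra_simps)
    then have "g p * (r p)\<^sup>2 = partial_v \<phi> p $ 2 - partial_v \<phi> p $ 1" "g p * r p = - partial_v \<phi> p $ 3"
      using g0[OF p] by (simp_all add: r_def power_divide, simp add: power2_eq_square)
    then show "partial_v \<phi> p = g p *\<^sub>R vector [- ((1 + (r p)\<^sup>2) / 2), - ((1 - (r p)\<^sup>2) / 2), - r p]"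
      by (simp add: vec_eq_iff forall_3 distrib_left right_diff_distrib) (simp add: g_def)
  qed
  \<comment> \<open>Two solutions for the same data have equal partials on the connected set
    \<open>S\<close>.\<close>
  have "\<exists>c. \<forall>p\<in>S. \<phi> p = \<psi> p + c" if W': "weierstrass_formulas S q r f g \<psi>" for \<psi>
    using weierstrass_formulasD[OF W] weierstrass_formulasD[OF W']
    by (intro partials_eq_imp_translate[OF S]) auto
  with hol ahol W show ?thesis unfolding weierstrass_representable_def by blast
qed

text \<open>Reflection interchanges \<open>\<phi>\<^sub>u\<close> and \<open>\<phi>\<^sub>v\<close>,
  so the denominators become the difference of the first two components of
  \<open>\<phi>\<^sub>v\<close> and minus the sum of those of \<open>\<phi>\<^sub>u\<close>.\<close>

lemma weierstrass_representable_swapI: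
  assumes S: "open S" "connected S" and sm: "smooth_on S \<phi>"
    and mixed: "\<And>p. p \<in> S \<Longrightarrow> partial_v (partial_u \<phi>) p = 0" "\<And>p. p \<in> S \<Longrightarrow> partial_u (partial_v \<phi>) p = 0"
    and null: "\<And>p. p \<in> S \<Longrightarrow> minkowski (partial_u \<phi> p) (partial_u \<phi> p) = 0"
      "\<And>p. p \<in> S \<Longrightarrow> minkowski (partial_v \<phi> p) (partial_v \<phi> p) = 0"
    and ne: "\<And>p. p \<in> S \<Longrightarrow> partial_v \<phi> p $ 1 \<noteq> partial_v \<phi> p $ 2"
      "\<And>p. p \<in> S \<Longrightarrow> partial_u \<phi> p $ 1 \<noteq> - partial_u \<phi> p $ 2"
  shows "weierstrass_representable (prod.swap ` S) (\<phi> \<circ> prod.swap)"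
proof -
  let ?T = "prod.swap ` S" and ?\<psi> = "\<lambda>p. \<phi> (prod.swap p)"
  have "?T = prod.swap -` S" by force
  then have T: "open ?T"
    using open_vimage[OF S(1) linear_continuous_on[OF bounded_linear_swap]] by simp
  have cT: "connected ?T"
    by (intro connected_continuous_image linear_continuous_on bounded_linear_swap S)
  have swap: "prod.swap p \<in> S" if "p \<in> ?T" for p using that by auto
  have d: "\<phi> differentiable (at (prod.swap p))" "partial_u \<phi> differentiable (at (prod.swap p))"
    "partial_v \<phi> differentiable (at (prod.swap p))" if "p \<in> ?T" for p
    using smooth_on_differentiable[OF sm swap[OF that]]
      smooth_on_differentiable[OF smooth_on_partial_u[OF sm] swap[OF that]]
      smooth_on_differentiable[OF smooth_on_partial_v[OF sm] swap[OF that]] by auto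
  have u: "partial_u ?\<psi> p = partial_v \<phi> (prod.swap p)" and v: "partial_v ?\<psi> p = partial_u \<phi> (prod.swap p)"
    if "p \<in> ?T" for p
    using partial_u_swap[OF d(1)[OF that]] partial_v_swap[OF d(1)[OF that]] by auto
  have "weierstrass_representable ?T ?\<psi>"
  proof (rule weierstrass_representableI[OF T cT])
    show "smooth_on ?T ?\<psi>"
      by (rule smooth_on_compose_linear[OF S(1) T bounded_linear_swap _ sm]) auto
    fix p assume p: "p \<in> ?T"
    have "partial_v (partial_u ?\<psi>) p = partial_v (\<lambda>p. partial_v \<phi> (prod.swap p)) p"
      using partial_v_cong[OF T p differentiable_swap[OF d(3)[OF p]], of "partial_u ?\<psi>"] u by simp
    then show "partial_v (partial_u ?\<psi>) p = 0"
      using partial_v_swap[OF d(3)[OF p]] mixed(2)[OF swap[OF p]] by simp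
    have "partial_u (partial_v ?\<psi>) p = partial_u (\<lambda>p. partial_u \<phi> (prod.swap p)) p"
      using partial_u_cong[OF T p differentiable_swap[OF d(2)[OF p]], of "partial_v ?\<psi>"] v by simp
    then show "partial_u (partial_v ?\<psi>) p = 0"
      using partial_u_swap[OF d(2)[OF p]] mixed(1)[OF swap[OF p]] by simp
  qed (use u v null ne swap in auto)
  then show ?thesis by (simp add: comp_def)
qed

section \<open>Localisation and the choice between the two coordinate orders\<close>

lemma open_contains_rectangle:
  assumes "open U" "p \<in> (U :: (real \<times> real) set)"
  obtains a b c d where "p \<in> {a<..<b} \<times> {c<..<d}" "{a<..<b} \<times> {c<..<d} \<subseteq> U"
proof -
  obtain A B where AB: "open A" "open B" "p \<in> A \<times> B" "A \<times> B \<subseteq> U"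
    using assms by (rule open_prod_elim)
  then obtain e d where "e > 0" "ball (fst p) e \<subseteq> A" "d > 0" "ball (snd p) d \<subseteq> B"
    by (metis mem_Times_iff openE)
  with AB that[of "fst p - e" "fst p + e" "snd p - d" "snd p + d"] show ?thesis
    by (auto simp: ball_eq_greaterThanLessThan mem_Times_iff)
qed

text \<open>For a null vector the square of the third component is the product of
  \<open>x $ 1 - x $ 2\<close> and \<open>x $ 1 + x $ 2\<close>, so either equation forces it to
  vanish. The two lines are the limits of the directions in the formulas as \<open>q\<close> or
  \<open>r\<close> tends to infinity.\<close>

lemma null_vector_in_span:
  assumes "minkowski x x = 0"
  shows "x \<in> span {vector [1, 1, 0]} \<longleftrightarrow> x $ 1 = x $ 2"
    and "x \<in> span {vector [1, -1, 0]} \<longleftrightarrow> x $ 1 = - x $ 2"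
  using assms
  by (auto simp: span_singleton vec_eq_iff forall_3 minkowski_def intro!: exI[of _ "x $ 1"] image_eqI[of _ _ "x $ 1"])

text \<open>If \<open>x $ 1 = x $ 2\<close>, nullity gives \<open>x $ 3 = 0\<close>, and
  \<open>minkowski x y\<close> is \<open>x $ 1\<close> times \<open>y $ 2 - y $ 1\<close>; both
  factors are then nonzero. The other case is symmetric.\<close>

lemma transversal_null_vectors:
  assumes "minkowski x x = 0" "minkowski y y = 0" "minkowski x y \<noteq> 0"
    and "x $ 1 = x $ 2 \<or> y $ 1 = - y $ 2"
  shows "x $ 1 + x $ 2 \<noteq> 0 \<and> y $ 1 - y $ 2 \<noteq> 0"
  using assms by (auto simp: minkowski_def add_eq_0_iff2)

text \<open>At each point one of the two pairs of denominators is nonzero, and by continuity it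
  stays so on a rectangle. Rectangles are connected and reflect to rectangles, so one of the two
  criteria applies.\<close>

lemma minimal_surface_representable:
  assumes M: "open M" "connected M" and min: "timelike_minimal_surface M \<phi> \<omega>"
  shows "p \<in> M \<Longrightarrow> \<exists>a b c d. p \<in> {a<..<b} \<times> {c<..<d} \<and> {a<..<b} \<times> {c<..<d} \<subseteq> M \<and>
      (weierstrass_representable ({a<..<b} \<times> {c<..<d}) \<phi> \<or>
       weierstrass_representable ({c<..<d} \<times> {a<..<b}) (\<phi> \<circ> prod.swap))"
    and "(\<And>p. p \<in> M \<Longrightarrow> partial_u \<phi> p \<notin> span {vector [1, 1, 0]} \<and>
        partial_v \<phi> p \<notin> span {vector [1, -1, 0]}) \<Longrightarrow> weierstrass_representable M \<phi>"
proof -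
  have sm: "smooth_on M \<phi>" and null: "null_coordinates M \<phi> \<omega>"
    using min unfolding timelike_minimal_surface_def timelike_surface_def by blast+
  let ?x = "partial_u \<phi>" and ?y = "partial_v \<phi>"
  have nu: "minkowski (?x p) (?x p) = 0" and nv: "minkowski (?y p) (?y p) = 0"
    and uv: "minkowski (?x p) (?y p) \<noteq> 0" if "p \<in> M" for p
    using null that by (auto simp: null_coordinates_def)
  note mixed = minimal_surface_mixed_partials_eq_0[OF M(1) min]
  show "weierstrass_representable M \<phi>" if "\<And>p. p \<in> M \<Longrightarrow> ?x p \<notin> span {vector [1, 1, 0]} \<and>
        ?y p \<notin> span {vector [1, -1, 0]}"
    using that null_vector_in_span[OF nu] null_vector_in_span[OF nv]
    by (intro weierstrass_representableI[OF M sm mixed nu nv]) auto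
  have cont: "continuous_on M (\<lambda>p. ?x p $ i)" "continuous_on M (\<lambda>p. ?y p $ i)" for i
    using smooth_on_continuous[OF smooth_on_partial_u[OF sm]] smooth_on_continuous[OF smooth_on_partial_v[OF sm]]
    by (auto intro: continuous_intros)
  have openU: "open {p \<in> M. h p \<noteq> 0 \<and> k p \<noteq> 0}"
    if "continuous_on M h" "continuous_on M k" for h k :: "real \<times> real \<Rightarrow> real"
  proof -
    have "{p \<in> M. h p \<noteq> 0 \<and> k p \<noteq> 0} = (M \<inter> h -` (- {0})) \<inter> (M \<inter> k -` (- {0}))" by auto
    then show ?thesis using that M(1) by (metis continuous_open_preimage open_Compl open_Int closed_singleton)
  qed
  assume p: "p \<in> M"
  show "\<exists>a b c d. p \<in> {a<..<b} \<times> {c<..<d} \<and> {a<..<b} \<times> {c<..<d} \<subseteq> M \<and>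
      (weierstrass_representable ({a<..<b} \<times> {c<..<d}) \<phi> \<or>
       weierstrass_representable ({c<..<d} \<times> {a<..<b}) (\<phi> \<circ> prod.swap))"
  proof (cases "?x p $ 1 - ?x p $ 2 \<noteq> 0 \<and> ?y p $ 1 + ?y p $ 2 \<noteq> 0")
    case True
    let ?U = "{p \<in> M. ?x p $ 1 - ?x p $ 2 \<noteq> 0 \<and> ?y p $ 1 + ?y p $ 2 \<noteq> 0}"
    have "open ?U" by (intro openU continuous_on_diff continuous_on_add cont)
    then obtain a b c d where R: "p \<in> {a<..<b} \<times> {c<..<d}" "{a<..<b} \<times> {c<..<d} \<subseteq> ?U"
      using open_contains_rectangle[of ?U p] True p by blast
    have "weierstrass_representable ({a<..<b} \<times> {c<..<d}) \<phi>"
    proof (rule weierstrass_representableI)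
      show "open ({a<..<b} \<times> {c<..<d})" "connected ({a<..<b} \<times> {c<..<d})"
        by (auto intro: open_Times connected_Times)
      show "smooth_on ({a<..<b} \<times> {c<..<d}) \<phi>"
        using R(2) by (intro smooth_on_subset[OF sm]) auto
    qed (use R(2) mixed nu nv in \<open>auto simp: subset_iff add_eq_0_iff2\<close>)
    with R show ?thesis by blast
  next
    case False
    \<comment> \<open>Failure of the first pair of denominators at \<open>p\<close> forces the
      second pair to be nonzero there.\<close>
    have "?x p $ 1 + ?x p $ 2 \<noteq> 0 \<and> ?y p $ 1 - ?y p $ 2 \<noteq> 0"
      using False by (intro transversal_null_vectors nu nv uv p) (auto simp: add_eq_0_iff2)
    let ?U = "{p \<in> M. ?x p $ 1 + ?x p $ 2 \<noteq> 0 \<and> ?y p $ 1 - ?y p $ 2 \<noteq> 0}"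
    have "open ?U" by (intro openU continuous_on_diff continuous_on_add cont)
    then obtain a b c d where R: "p \<in> {a<..<b} \<times> {c<..<d}" "{a<..<b} \<times> {c<..<d} \<subseteq> ?U"
      using open_contains_rectangle[of ?U p] \<open>?x p $ 1 + ?x p $ 2 \<noteq> 0 \<and> _\<close> p by blast
    have "weierstrass_representable (prod.swap ` ({a<..<b} \<times> {c<..<d})) (\<phi> \<circ> prod.swap)"
    proof (rule weierstrass_representable_swapI)
      show "open ({a<..<b} \<times> {c<..<d})" "connected ({a<..<b} \<times> {c<..<d})"
        by (auto intro: open_Times connected_Times)
      show "smooth_on ({a<..<b} \<times> {c<..<d}) \<phi>"
        using R(2) by (intro smooth_on_subset[OF sm]) auto
    qed (use R(2) mixed nu nv in \<open>auto simp: subset_iff add_eq_0_iff2\<close>)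
    then have "weierstrass_representable ({c<..<d} \<times> {a<..<b}) (\<phi> \<circ> prod.swap)"
      by (simp add: product_swap)
    with R show ?thesis by blast
  qed
qed

text \<open>Each clause carries the condition its argument rests on: dependence on one coordinate
  over all of \<open>M\<close> for integrating the formulas, positivity for the logarithm, and for
  the global converse the exclusion of the null directions that no finite \<open>q\<close> or
  \<open>r\<close> yields. In general the converse is local, possibly with the coordinates
  exchanged.\<close>

theorem theorem7:
  fixes M :: "(real \<times> real) set"
  assumes "open M" and "connected M"
  shows
    "(\<forall>q r f g.
        lorentz_holomorphic M q \<and> lorentz_antiholomorphic M r \<and>
        lorentz_holomorphic M f \<and> lorentz_antiholomorphic M g \<longrightarrow>
        (function_of_u M q \<and> function_of_v M r \<and> function_of_u M f \<and> function_of_v M g \<longrightarrow>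
           (\<exists>\<phi>. weierstrass_formulas M q r f g \<phi>)) \<and>
        (\<forall>\<phi>. weierstrass_formulas M q r f g \<phi> \<longrightarrow>
           (\<forall>p\<in>M. \<forall>du dv. induced_metric \<phi> p (du, dv) (du, dv)
                            = (1 + q p * r p)\<^sup>2 * f p * g p * du * dv) \<and>
           ((\<forall>p\<in>M. 0 < (1 + q p * r p)\<^sup>2 * f p * g p) \<longrightarrow>
              timelike_minimal_surface M \<phi> (\<lambda>p. ln ((1 + q p * r p)\<^sup>2 * f p * g p)))))
     \<and>
     (\<forall>\<phi> \<omega>. timelike_minimal_surface M \<phi> \<omega> \<longrightarrow>
        (\<forall>p\<in>M. \<exists>a b c d. p \<in> {a<..<b} \<times> {c<..<d} \<and> {a<..<b} \<times> {c<..<d} \<subseteq> M \<and>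
           (weierstrass_representable ({a<..<b} \<times> {c<..<d}) \<phi> \<or>
            weierstrass_representable ({c<..<d} \<times> {a<..<b}) (\<phi> \<circ> prod.swap))) \<and>
        ((\<forall>p\<in>M. partial_u \<phi> p \<notin> span {vector [1, 1, 0]} \<and>
                 partial_v \<phi> p \<notin> span {vector [1, -1, 0]}) \<longrightarrow>
           weierstrass_representable M \<phi>))"
proof (intro conjI allI impI ballI; (elim conjE)?)
  fix q r f g
  assume h: "lorentz_holomorphic M q" "lorentz_antiholomorphic M r"
    "lorentz_holomorphic M f" "lorentz_antiholomorphic M g"
  show "\<exists>\<phi>. weierstrass_formulas M q r f g \<phi>"
    if "function_of_u M q" "function_of_v M r" "function_of_u M f" "function_of_v M g"
    using h that
    by (intro weierstrass_formulas_integrable assms)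
      (auto simp: lorentz_holomorphic_def lorentz_antiholomorphic_def intro: smooth_on_continuous)
  fix \<phi>
  assume W: "weierstrass_formulas M q r f g \<phi>"
  show "induced_metric \<phi> p (du, dv) (du, dv) = (1 + q p * r p)\<^sup>2 * f p * g p * du * dv"
    if "p \<in> M" for p du dv
    unfolding weierstrass_induced_metric[OF W that] by (simp add: algebra_simps)
  show "timelike_minimal_surface M \<phi> (\<lambda>p. ln ((1 + q p * r p)\<^sup>2 * f p * g p))"
    if "\<forall>p\<in>M. 0 < (1 + q p * r p)\<^sup>2 * f p * g p"
    using weierstrass_minimal[OF assms(1) h(1,3,2,4) W] that by blast
next
  fix \<phi> \<omega>
  assume min: "timelike_minimal_surface M \<phi> \<omega>"
  show "\<exists>a b c d. p \<in> {a<..<b} \<times> {c<..<d} \<and> {a<..<b} \<times> {c<..<d} \<subseteq> M \<and>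
      (weierstrass_representable ({a<..<b} \<times> {c<..<d}) \<phi> \<or>
       weierstrass_representable ({c<..<d} \<times> {a<..<b}) (\<phi> \<circ> prod.swap))" if "p \<in> M" for p
    by (rule minimal_surface_representable(1)[OF assms min that])
  show "weierstrass_representable M \<phi>"
    if "\<forall>p\<in>M. partial_u \<phi> p \<notin> span {vector [1, 1, 0]} \<and> partial_v \<phi> p \<notin> span {vector [1, -1, 0]}"
    using minimal_surface_representable(2)[OF assms min] that by blast
qed

end
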